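(* The variety $\mathsf{SNA}$ of subresiduated Nelson algebras has the congruence extension property: for every $T\in\mathsf{SNA}$, every subalgebra $U$ of $T$ and every congruence $\theta$ of $U$, there exists a congruence $\hat\theta$ of $T$ such that $\theta=\hat\theta\cap U^2$.
   Context: A Kleene algebra is a bounded distributive lattice $\langle T,\wedge,\vee,0,1\rangle$ with a unary operation $\sim$ satisfying $\sim\sim x=x$, $\sim(x\wedge y)=\sim x\vee\sim y$, $(x\wedge\sim x)\wedge(y\vee\sim y)=x\wedge\sim x$. A subresiduated Nelson algebra is an algebra $\langle T,\wedge,\vee,\to,\sim,0,1\rangle$ of type $(2,2,2,1,0,0)$ such that $\langle T,\wedge,\vee,\sim,0,1\rangle$ is a Kleene algebra and for all $x,y,z\in T$: (1) $(x\vee y)\to z=(x\to z)\wedge(y\to z)$; (2) $z\to(x\wedge y)=(z\to x)\wedge(z\to y)$; (3) $((x\to y)\wedge(y\to z))\to(x\to z)=1$; (4) $x\to x=1$; (5) $x\wedge(x\to y)\le x\wedge(\sim x\vee y)$; (6) $x\to y\le z\to(x\to y)$; (7) $\sim(x\to y)\to(x\wedge\sim y)=1$; (8) $(x\wedge\sim y)\to\sim(x\to y)=1$. *)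

theory Defs
  imports Main
begin

unbundle lattice_syntax

text \<open>The bounds \<open>0\<close> and \<open>1\<close> of the algebras are written \<open>\<bottom>\<close> and \<open>\<top>\<close>.\<close>

class kleene_lattice = distrib_lattice + bounded_lattice +
  fixes neg :: "'a \<Rightarrow> 'a"  ("\<sim> _" [81] 80)
  assumes neg_neg: "\<sim> (\<sim> x) = x"
    and neg_inf: "\<sim> (x \<sqinter> y) = \<sim> x \<squnion> \<sim> y"
    and kleene: "(x \<sqinter> \<sim> x) \<sqinter> (y \<squnion> \<sim> y) = x \<sqinter> \<sim> x"

class subresiduated_nelson_algebra = kleene_lattice +
  fixes imp :: "'a \<Rightarrow> 'a \<Rightarrow> 'a"  (infixr "\<rightharpoonup>" 55)
  assumes sup_imp: "(x \<squnion> y) \<rightharpoonup> z = (x \<rightharpoonup> z) \<sqinter> (y \<rightharpoonup> z)"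
    and imp_inf: "z \<rightharpoonup> (x \<sqinter> y) = (z \<rightharpoonup> x) \<sqinter> (z \<rightharpoonup> y)"
    and imp_trans: "((x \<rightharpoonup> y) \<sqinter> (y \<rightharpoonup> z)) \<rightharpoonup> (x \<rightharpoonup> z) = \<top>"
    and imp_refl: "x \<rightharpoonup> x = \<top>"
    and inf_imp_le: "x \<sqinter> (x \<rightharpoonup> y) \<le> x \<sqinter> (\<sim> x \<squnion> y)"
    and imp_le_imp: "x \<rightharpoonup> y \<le> z \<rightharpoonup> (x \<rightharpoonup> y)"
    and neg_imp_imp: "\<sim> (x \<rightharpoonup> y) \<rightharpoonup> (x \<sqinter> \<sim> y) = \<top>"
    and imp_neg_imp: "(x \<sqinter> \<sim> y) \<rightharpoonup> \<sim> (x \<rightharpoonup> y) = \<top>"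

definition subalgebra :: "'a::subresiduated_nelson_algebra set \<Rightarrow> bool" where
  "subalgebra U \<longleftrightarrow>
     \<bottom> \<in> U \<and> \<top> \<in> U \<and>
     (\<forall>x\<in>U. \<sim> x \<in> U) \<and>
     (\<forall>x\<in>U. \<forall>y\<in>U. x \<sqinter> y \<in> U \<and> x \<squnion> y \<in> U \<and> (x \<rightharpoonup> y) \<in> U)"

text \<open>Congruences of a subalgebra \<open>U\<close>; those of the whole algebra are the case \<open>U = UNIV\<close>.\<close>

definition congruence_on ::
    "'a::subresiduated_nelson_algebra set \<Rightarrow> ('a \<times> 'a) set \<Rightarrow> bool" where
  "congruence_on U \<theta> \<longleftrightarrow>
     equiv U \<theta> \<and>
     (\<forall>x y. (x, y) \<in> \<theta> \<longrightarrow> (\<sim> x, \<sim> y) \<in> \<theta>) \<and>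
     (\<forall>x y x' y'. (x, y) \<in> \<theta> \<longrightarrow> (x', y') \<in> \<theta> \<longrightarrow>
        (x \<sqinter> x', y \<sqinter> y') \<in> \<theta> \<and>
        (x \<squnion> x', y \<squnion> y') \<in> \<theta> \<and>
        (x \<rightharpoonup> x', y \<rightharpoonup> y') \<in> \<theta>)"

end

theory Submission
  imports Defs
begin

text \<open>
  Congruences of a subresiduated Nelson algebra are determined by the class of \<open>\<top>\<close>, and the
  subsets arising as such classes can be extended from a subalgebra to the whole algebra.

  Write \<open>x\<close> entails \<open>y\<close> for \<open>x \<rightharpoonup> y = \<top>\<close>. This is a preorder containing \<open>\<le>\<close>, for which \<open>\<sqinter>\<close> and
  \<open>\<squnion>\<close> are still meet and join. It is in general coarser than \<open>\<le>\<close>, since \<open>x \<sqinter> \<sim> x\<close> always entails \<open>\<bottom>\<close>,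
  and only with respect to it (not with respect to \<open>\<le>\<close>) does modus ponens
  \<open>x \<sqinter> (x \<rightharpoonup> y)\<close> entails \<open>y\<close> hold. The right notion of filter is therefore a set closed
  under meets and upwards under entailment. Such a filter \<open>F\<close> induces a congruence: \<open>x\<close> and \<open>y\<close> are
  related iff the biconditional \<open>x \<leftrightharpoons> y\<close>, the meet of \<open>x \<rightharpoonup> y\<close>, \<open>\<sim> x \<rightharpoonup> \<sim> y\<close> and their
  converses, lies in \<open>F\<close> (lemma \<open>congruence_on_filter_congruence\<close>). The negated halves are
  indispensable, because \<open>\<rightharpoonup>\<close> alone cannot separate \<open>x \<sqinter> \<sim> x\<close> from \<open>\<bottom>\<close>.

  Conversely every congruence \<open>\<theta>\<close> of a subalgebra \<open>U\<close> relates \<open>x, y \<in> U\<close> exactly when it relates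
  \<open>x \<leftrightharpoons> y\<close> to \<open>\<top>\<close>; this is where the Kleene inequality enters (lemma \<open>congruence_on_iff_bicond\<close>).

  Now let \<open>F\<close> consist of everything in the whole algebra that is entailed by some \<open>f\<close> with
  \<open>(f, \<top>) \<in> \<theta>\<close>. It is a filter, so it induces a congruence of the whole algebra. Its
  trace on \<open>U\<close> is just the \<open>\<theta>\<close>-class of \<open>\<top>\<close>: if \<open>f \<rightharpoonup> x = \<top>\<close> with \<open>x \<in> U\<close>, then \<open>\<theta>\<close> relates \<open>\<top> = f \<rightharpoonup> x\<close> to
  \<open>\<top> \<rightharpoonup> x \<le> x\<close>, hence to \<open>x\<close>. So the induced congruence restricts to \<open>\<theta>\<close>.
\<close>

section \<open>The entailment preorder\<close>

abbreviation entails :: "'a::subresiduated_nelson_algebra \<Rightarrow> 'a \<Rightarrow> bool"  (infix "\<preceq>" 50) where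
  "x \<preceq> y \<equiv> x \<rightharpoonup> y = \<top>"

lemma neg_antimono:
  fixes x y :: "'a::kleene_lattice"
  assumes "x \<le> y"
  shows "\<sim> y \<le> \<sim> x"
  using assms by (metis inf.absorb1 neg_inf sup.cobounded2)

lemma neg_top: "\<sim> \<top> = (\<bottom>::'a::kleene_lattice)"
  by (metis bot.extremum_uniqueI neg_antimono neg_neg top_greatest)

lemma neg_sup:
  fixes x y :: "'a::kleene_lattice"
  shows "\<sim> (x \<squnion> y) = \<sim> x \<sqinter> \<sim> y"
  by (metis neg_inf neg_neg)

text \<open>The operation \<open>\<lambda>x. \<top> \<rightharpoonup> x\<close> is an interior operator, and the values of \<open>\<rightharpoonup>\<close> are open.\<close>

lemma top_imp_le:
  fixes x :: "'a::subresiduated_nelson_algebra"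
  shows "\<top> \<rightharpoonup> x \<le> x"
  using inf_imp_le[of \<top> x] by (simp add: neg_top)

lemma imp_right_mono:
  fixes x y z :: "'a::subresiduated_nelson_algebra"
  assumes "y \<le> z"
  shows "x \<rightharpoonup> y \<le> x \<rightharpoonup> z"
  using imp_inf[of x y z] unfolding inf.absorb1[OF assms] by (rule inf.orderI)

lemma imp_left_antimono:
  fixes x y z :: "'a::subresiduated_nelson_algebra"
  assumes "x \<le> y"
  shows "y \<rightharpoonup> z \<le> x \<rightharpoonup> z"
  using sup_imp[of x y z] unfolding sup.absorb2[OF assms] inf.absorb_iff2 by (rule sym)

lemma le_imp_entails:
  fixes x y :: "'a::subresiduated_nelson_algebra"
  assumes "x \<le> y"
  shows "x \<preceq> y"
  using imp_right_mono[OF assms, of x] by (simp add: imp_refl top.extremum_unique)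

lemma entails_inf:
  fixes x y z :: "'a::subresiduated_nelson_algebra"
  shows "x \<preceq> y \<Longrightarrow> x \<preceq> z \<Longrightarrow> x \<preceq> y \<sqinter> z"
  by (simp add: imp_inf)

lemma entails_sup:
  fixes x y z :: "'a::subresiduated_nelson_algebra"
  shows "x \<preceq> z \<Longrightarrow> y \<preceq> z \<Longrightarrow> x \<squnion> y \<preceq> z"
  by (simp add: sup_imp)

lemma entails_trans:
  fixes x y z :: "'a::subresiduated_nelson_algebra"
  assumes "x \<preceq> y" "y \<preceq> z"
  shows "x \<preceq> z"
  using imp_trans[of x y z] assms top_imp_le[of "x \<rightharpoonup> z"] by (simp add: top.extremum_unique)

text \<open>
  Here entailment departs from the order: the axioms for \<open>\<sim> (x \<rightharpoonup> y)\<close> make \<open>x \<sqinter> \<sim> x\<close>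
  equivalent to \<open>\<sim> (x \<rightharpoonup> x) = \<bottom>\<close>, although \<open>x \<sqinter> \<sim> x\<close> need not be \<open>\<bottom>\<close>.
\<close>

lemma inf_neg_entails_bot:
  fixes x :: "'a::subresiduated_nelson_algebra"
  shows "x \<sqinter> \<sim> x \<preceq> \<bottom>"
  using imp_neg_imp[of x x] by (simp add: imp_refl neg_top)

lemma modus_ponens:
  fixes x y :: "'a::subresiduated_nelson_algebra"
  shows "x \<sqinter> (x \<rightharpoonup> y) \<preceq> y"
proof -
  have "x \<sqinter> \<sim> x \<preceq> y"
    by (meson bot_least entails_trans inf_neg_entails_bot le_imp_entails)
  then have "x \<sqinter> (\<sim> x \<squnion> y) \<preceq> y"
    by (simp add: inf_sup_distrib1 entails_sup le_imp_entails)
  then show ?thesis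
    by (meson entails_trans inf_imp_le le_imp_entails)
qed

text \<open>
  Openness of \<open>a\<close> gives \<open>a \<le> \<top> \<rightharpoonup> a \<le> x \<rightharpoonup> a\<close>, hence \<open>a \<le> x \<rightharpoonup> (a \<sqinter> x)\<close>, and the second
  hypothesis weakens the consequent to \<open>y\<close>.
\<close>

lemma open_residuation:
  fixes a x y :: "'a::subresiduated_nelson_algebra"
  assumes "a \<le> \<top> \<rightharpoonup> a" "a \<sqinter> x \<preceq> y"
  shows "a \<preceq> x \<rightharpoonup> y"
proof -
  have "a \<le> x \<rightharpoonup> a"
    using assms(1) imp_left_antimono[of x \<top> a] by (meson order_trans top_greatest)
  then have "a \<le> x \<rightharpoonup> (a \<sqinter> x)"
    by (simp add: imp_inf imp_refl)
  moreover have "x \<rightharpoonup> (a \<sqinter> x) \<preceq> x \<rightharpoonup> y"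
    using imp_trans[of x "a \<sqinter> x" y] assms(2) by simp
  ultimately show ?thesis
    by (meson entails_trans le_imp_entails)
qed

text \<open>
  Monotonicity of \<open>\<rightharpoonup>\<close> internalised. The meet on the left is open, so by residuation it is enough
  to chain the three implications \<open>y \<rightharpoonup> x\<close>, \<open>x \<rightharpoonup> x'\<close>, \<open>x' \<rightharpoonup> y'\<close>.
\<close>

lemma imp_mono_entails:
  fixes x y x' y' :: "'a::subresiduated_nelson_algebra"
  shows "(y \<rightharpoonup> x) \<sqinter> (x' \<rightharpoonup> y') \<preceq> (x \<rightharpoonup> x') \<rightharpoonup> (y \<rightharpoonup> y')"
proof (rule open_residuation)
  let ?a = "(y \<rightharpoonup> x) \<sqinter> (x' \<rightharpoonup> y')"
  show "?a \<le> \<top> \<rightharpoonup> ?a"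
    unfolding imp_inf[of \<top> "y \<rightharpoonup> x"] by (intro inf_mono imp_le_imp)
  have "?a \<sqinter> (x \<rightharpoonup> x') \<preceq> y \<rightharpoonup> x'"
    by (rule entails_trans[OF le_imp_entails imp_trans[of y x x']]) (simp add: le_infI1)
  moreover have "?a \<sqinter> (x \<rightharpoonup> x') \<preceq> x' \<rightharpoonup> y'"
    by (rule le_imp_entails) (simp add: le_infI1)
  ultimately show "?a \<sqinter> (x \<rightharpoonup> x') \<preceq> y \<rightharpoonup> y'"
    using entails_inf entails_trans imp_trans by blast
qed

section \<open>Filters closed under entailment and their congruences\<close>

definition entailment_filter :: "'a::subresiduated_nelson_algebra set \<Rightarrow> bool" where
  "entailment_filter F \<longleftrightarrow>
     \<top> \<in> F \<and> (\<forall>x\<in>F. \<forall>y\<in>F. x \<sqinter> y \<in> F) \<and> (\<forall>x\<in>F. \<forall>y. x \<preceq> y \<longrightarrow> y \<in> F)"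

definition bicond :: "'a::subresiduated_nelson_algebra \<Rightarrow> 'a \<Rightarrow> 'a"  (infix "\<leftrightharpoons>" 55) where
  "x \<leftrightharpoons> y = ((x \<rightharpoonup> y) \<sqinter> (y \<rightharpoonup> x)) \<sqinter> ((\<sim> x \<rightharpoonup> \<sim> y) \<sqinter> (\<sim> y \<rightharpoonup> \<sim> x))"

definition filter_congruence :: "'a::subresiduated_nelson_algebra set \<Rightarrow> ('a \<times> 'a) set" where
  "filter_congruence F = {(x, y). x \<leftrightharpoons> y \<in> F}"

context
  fixes F :: "'a::subresiduated_nelson_algebra set"
  assumes F: "entailment_filter F"
begin

lemma filter_entails: "x \<in> F \<Longrightarrow> x \<preceq> y \<Longrightarrow> y \<in> F"
  using F by (auto simp: entailment_filter_def)

lemma filter_inf_iff: "x \<sqinter> y \<in> F \<longleftrightarrow> x \<in> F \<and> y \<in> F"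
  using F filter_entails[OF _ le_imp_entails]
  by (meson entailment_filter_def inf.cobounded1 inf.cobounded2)

lemma filter_congruence_iff:
  "(x, y) \<in> filter_congruence F \<longleftrightarrow>
     x \<rightharpoonup> y \<in> F \<and> y \<rightharpoonup> x \<in> F \<and> \<sim> x \<rightharpoonup> \<sim> y \<in> F \<and> \<sim> y \<rightharpoonup> \<sim> x \<in> F"
  by (auto simp: filter_congruence_def bicond_def filter_inf_iff)

lemma filter_imp_entails: "x \<preceq> y \<Longrightarrow> x \<rightharpoonup> y \<in> F"
  using F by (simp add: entailment_filter_def)

lemma filter_imp_trans: "x \<rightharpoonup> y \<in> F \<Longrightarrow> y \<rightharpoonup> z \<in> F \<Longrightarrow> x \<rightharpoonup> z \<in> F"
  by (rule filter_entails[OF _ imp_trans[of x y z]]) (simp add: filter_inf_iff)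

lemma filter_inf_mono:
  assumes "x \<rightharpoonup> y \<in> F" "x' \<rightharpoonup> y' \<in> F"
  shows "x \<sqinter> x' \<rightharpoonup> y \<sqinter> y' \<in> F"
  using assms filter_imp_trans[OF filter_imp_entails[OF le_imp_entails]]
  by (metis filter_inf_iff imp_inf inf.cobounded1 inf.cobounded2)

lemma filter_sup_mono:
  assumes "x \<rightharpoonup> y \<in> F" "x' \<rightharpoonup> y' \<in> F"
  shows "x \<squnion> x' \<rightharpoonup> y \<squnion> y' \<in> F"
  using assms filter_imp_trans[OF _ filter_imp_entails[OF le_imp_entails]]
  by (metis filter_inf_iff sup_imp sup.cobounded1 sup.cobounded2)

lemma filter_imp_mono:
  assumes "y \<rightharpoonup> x \<in> F" "x' \<rightharpoonup> y' \<in> F"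
  shows "(x \<rightharpoonup> x') \<rightharpoonup> (y \<rightharpoonup> y') \<in> F"
  by (rule filter_entails[OF _ imp_mono_entails]) (simp add: filter_inf_iff assms)

text \<open>Up to entailment, \<open>\<sim> (x \<rightharpoonup> x')\<close> is the meet \<open>x \<sqinter> \<sim> x'\<close>, which is monotone.\<close>

lemma filter_neg_imp_mono:
  assumes "x \<rightharpoonup> y \<in> F" "\<sim> x' \<rightharpoonup> \<sim> y' \<in> F"
  shows "\<sim> (x \<rightharpoonup> x') \<rightharpoonup> \<sim> (y \<rightharpoonup> y') \<in> F"
proof -
  have "x \<sqinter> \<sim> x' \<rightharpoonup> y \<sqinter> \<sim> y' \<in> F"
    using assms by (rule filter_inf_mono)
  then show ?thesis
    by (meson filter_imp_trans filter_imp_entails neg_imp_imp imp_neg_imp)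
qed

theorem congruence_on_filter_congruence: "congruence_on UNIV (filter_congruence F)"
proof -
  have "equiv UNIV (filter_congruence F)"
  proof (rule equivI)
    show "refl (filter_congruence F)"
      by (auto simp: refl_on_def filter_congruence_iff intro: filter_imp_entails imp_refl)
    show "sym (filter_congruence F)"
      by (auto simp: sym_def filter_congruence_iff)
    show "trans (filter_congruence F)"
      unfolding trans_def filter_congruence_iff by (blast intro: filter_imp_trans)
  qed simp
  then show ?thesis
    by (auto simp: congruence_on_def filter_congruence_iff neg_neg neg_inf neg_sup
        intro: filter_inf_mono filter_sup_mono filter_imp_mono filter_neg_imp_mono)
qed

end

section \<open>Congruences of a subalgebra and the class of the top element\<close>

context
  fixes U :: "'a::subresiduated_nelson_algebra set" and \<theta> :: "('a \<times> 'a) set"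
  assumes U: "subalgebra U" and \<theta>: "congruence_on U \<theta>"
begin

lemma cong_in: "(x, y) \<in> \<theta> \<Longrightarrow> x \<in> U \<and> y \<in> U"
  using \<theta> by (auto simp: congruence_on_def equiv_def)

lemma cong_refl: "x \<in> U \<Longrightarrow> (x, x) \<in> \<theta>"
  using \<theta> by (auto simp: congruence_on_def equiv_def refl_on_def)

lemma cong_sym: "(x, y) \<in> \<theta> \<Longrightarrow> (y, x) \<in> \<theta>"
  using \<theta> by (auto simp: congruence_on_def equiv_def dest: symD)

lemma cong_trans: "(x, y) \<in> \<theta> \<Longrightarrow> (y, z) \<in> \<theta> \<Longrightarrow> (x, z) \<in> \<theta>"
  using \<theta> by (auto simp: congruence_on_def equiv_def dest: transD)

lemma cong_neg: "(x, y) \<in> \<theta> \<Longrightarrow> (\<sim> x, \<sim> y) \<in> \<theta>"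
  and cong_inf: "(x, y) \<in> \<theta> \<Longrightarrow> (x', y') \<in> \<theta> \<Longrightarrow> (x \<sqinter> x', y \<sqinter> y') \<in> \<theta>"
  and cong_sup: "(x, y) \<in> \<theta> \<Longrightarrow> (x', y') \<in> \<theta> \<Longrightarrow> (x \<squnion> x', y \<squnion> y') \<in> \<theta>"
  and cong_imp: "(x, y) \<in> \<theta> \<Longrightarrow> (x', y') \<in> \<theta> \<Longrightarrow> (x \<rightharpoonup> x', y \<rightharpoonup> y') \<in> \<theta>"
  using \<theta> by (auto simp: congruence_on_def)

lemma sub_closed:
  "\<top> \<in> U"
  "x \<in> U \<Longrightarrow> \<sim> x \<in> U"
  "x \<in> U \<Longrightarrow> y \<in> U \<Longrightarrow> x \<sqinter> y \<in> U"
  "x \<in> U \<Longrightarrow> y \<in> U \<Longrightarrow> x \<squnion> y \<in> U"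
  "x \<in> U \<Longrightarrow> y \<in> U \<Longrightarrow> x \<rightharpoonup> y \<in> U"
  using U by (auto simp: subalgebra_def)

lemma cong_top_upward:
  assumes "(x, \<top>) \<in> \<theta>" "x \<le> y" "y \<in> U"
  shows "(y, \<top>) \<in> \<theta>"
  using cong_sup[OF assms(1) cong_refl[OF assms(3)]] assms(2) by (simp add: sup.absorb2)

lemma cong_top_entails:
  assumes "(x, \<top>) \<in> \<theta>" "x \<preceq> y" "y \<in> U"
  shows "(y, \<top>) \<in> \<theta>"
proof -
  have "(\<top> \<rightharpoonup> y, \<top>) \<in> \<theta>"
    using cong_sym[OF cong_imp[OF assms(1) cong_refl[OF assms(3)]]] assms(2) by simp
  then show ?thesis
    using top_imp_le assms(3) by (rule cong_top_upward)
qed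

lemma cong_imp_top:
  assumes "(x \<rightharpoonup> y, \<top>) \<in> \<theta>" "x \<in> U" "y \<in> U"
  shows "(x, x \<sqinter> (\<sim> x \<squnion> y)) \<in> \<theta>"
proof -
  let ?z = "x \<sqinter> (\<sim> x \<squnion> y)"
  have z: "?z \<in> U"
    using assms by (simp add: sub_closed)
  have x: "(x \<sqinter> (x \<rightharpoonup> y), x) \<in> \<theta>"
    using cong_inf[OF cong_refl[OF assms(2)] assms(1)] by simp
  have "(x \<sqinter> (x \<rightharpoonup> y) \<squnion> ?z, x \<squnion> ?z) \<in> \<theta>"
    using x cong_refl[OF z] by (rule cong_sup)
  then have "(?z, x) \<in> \<theta>"
    by (simp add: sup.absorb2[OF inf_imp_le] sup_inf_absorb)
  then show ?thesis
    by (rule cong_sym)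
qed

text \<open>
  In the quotient the hypotheses read \<open>x \<le> \<sim> x \<squnion> y\<close> and \<open>x \<sqinter> \<sim> y \<le> y\<close> (the second one by
  contraposition). Hence \<open>x = (x \<sqinter> \<sim> x) \<squnion> (x \<sqinter> y)\<close>, and the Kleene inequality
  \<open>x \<sqinter> \<sim> x \<le> y \<squnion> \<sim> y\<close> bounds the first part by \<open>(x \<sqinter> y) \<squnion> (x \<sqinter> \<sim> y) = x \<sqinter> y\<close>.
\<close>

lemma cong_le_of_imps:
  assumes imp: "(x \<rightharpoonup> y, \<top>) \<in> \<theta>" and contra: "(\<sim> y \<rightharpoonup> \<sim> x, \<top>) \<in> \<theta>"
    and x: "x \<in> U" and y: "y \<in> U"
  shows "(x, x \<sqinter> y) \<in> \<theta>"
proof -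
  let ?m = "(x \<sqinter> y) \<squnion> (x \<sqinter> \<sim> y)"
  have "(\<sim> y, \<sim> y \<sqinter> (y \<squnion> \<sim> x)) \<in> \<theta>"
    using cong_imp_top[OF contra] x y by (simp add: sub_closed neg_neg)
  from cong_neg[OF this] have "(y, y \<squnion> (\<sim> y \<sqinter> x)) \<in> \<theta>"
    by (simp add: neg_neg neg_inf neg_sup)
  from cong_inf[OF cong_refl[OF x] this] have m: "(x \<sqinter> y, ?m) \<in> \<theta>"
    by (simp add: inf_sup_distrib1 inf.commute[of "\<sim> y"])
  have "(x, (x \<sqinter> \<sim> x) \<squnion> (x \<sqinter> y)) \<in> \<theta>"
    using cong_imp_top[OF imp x y] by (simp add: inf_sup_distrib1)
  moreover have "((x \<sqinter> \<sim> x) \<squnion> (x \<sqinter> y), (x \<sqinter> \<sim> x) \<squnion> ?m) \<in> \<theta>"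
    using x m by (intro cong_sup cong_refl) (simp_all add: sub_closed)
  moreover have "(x \<sqinter> \<sim> x) \<squnion> ?m = ?m"
  proof (rule sup.absorb2)
    have "x \<sqinter> \<sim> x \<le> y \<squnion> \<sim> y"
      by (metis inf.cobounded2 kleene)
    then show "x \<sqinter> \<sim> x \<le> ?m"
      by (simp add: inf_sup_distrib1[symmetric] le_infI1)
  qed
  ultimately have "(x, ?m) \<in> \<theta>"
    using cong_trans by simp
  then show ?thesis
    using cong_trans cong_sym[OF m] by blast
qed

lemma bicond_in: "x \<in> U \<Longrightarrow> y \<in> U \<Longrightarrow> x \<leftrightharpoons> y \<in> U"
  by (simp add: bicond_def sub_closed)

lemma congruence_on_iff_bicond:
  assumes x: "x \<in> U" and y: "y \<in> U"
  shows "(x, y) \<in> \<theta> \<longleftrightarrow> (x \<leftrightharpoons> y, \<top>) \<in> \<theta>"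
proof
  assume xy: "(x, y) \<in> \<theta>"
  have "(a \<rightharpoonup> b, \<top>) \<in> \<theta>" if "(a, b) \<in> \<theta>" for a b
    using cong_imp[OF that cong_refl, of b] cong_in[OF that] by (simp add: imp_refl)
  then have "(x \<leftrightharpoons> y, (\<top> \<sqinter> \<top>) \<sqinter> (\<top> \<sqinter> \<top>)) \<in> \<theta>"
    unfolding bicond_def using xy by (intro cong_inf) (auto intro: cong_neg cong_sym)
  then show "(x \<leftrightharpoons> y, \<top>) \<in> \<theta>"
    by simp
next
  assume top: "(x \<leftrightharpoons> y, \<top>) \<in> \<theta>"
  have "(x \<rightharpoonup> y, \<top>) \<in> \<theta>" "(y \<rightharpoonup> x, \<top>) \<in> \<theta>" "(\<sim> x \<rightharpoonup> \<sim> y, \<top>) \<in> \<theta>" "(\<sim> y \<rightharpoonup> \<sim> x, \<top>) \<in> \<theta>"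
    by (rule cong_top_upward[OF top]; simp add: bicond_def x y sub_closed le_infI1 le_infI2)+
  then have "(x, x \<sqinter> y) \<in> \<theta>" "(y, y \<sqinter> x) \<in> \<theta>"
    using x y by (auto intro: cong_le_of_imps)
  then show "(x, y) \<in> \<theta>"
    by (metis cong_sym cong_trans inf.commute)
qed

text \<open>
  The least entailment filter of the whole algebra containing the \<open>\<theta>\<close>-class of \<open>\<top>\<close>; it is the
  class of \<open>\<top>\<close> in the extended congruence.
\<close>

definition top_class_closure :: "'a set" where
  "top_class_closure = {x. \<exists>f. (f, \<top>) \<in> \<theta> \<and> f \<preceq> x}"

lemma entailment_filter_top_class_closure: "entailment_filter top_class_closure"
  unfolding entailment_filter_def
proof (intro conjI ballI allI impI)
  show "\<top> \<in> top_class_closure"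
    using cong_refl sub_closed(1) imp_refl by (auto simp: top_class_closure_def)
next
  fix x y assume "x \<in> top_class_closure" "y \<in> top_class_closure"
  then obtain f g where fg: "(f, \<top>) \<in> \<theta>" "f \<preceq> x" "(g, \<top>) \<in> \<theta>" "g \<preceq> y"
    by (auto simp: top_class_closure_def)
  have "(f \<sqinter> g, \<top>) \<in> \<theta>"
    using cong_inf[OF fg(1,3)] by simp
  moreover have "f \<sqinter> g \<preceq> x \<sqinter> y"
    using fg(2,4) by (meson entails_inf entails_trans inf.cobounded1 inf.cobounded2 le_imp_entails)
  ultimately show "x \<sqinter> y \<in> top_class_closure"
    by (auto simp: top_class_closure_def)
next
  fix x y assume "x \<in> top_class_closure" "x \<preceq> y"
  then show "y \<in> top_class_closure"
    using entails_trans by (auto simp: top_class_closure_def)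
qed

lemma top_class_closure_iff:
  assumes "x \<in> U"
  shows "x \<in> top_class_closure \<longleftrightarrow> (x, \<top>) \<in> \<theta>"
  using assms cong_top_entails imp_refl by (auto simp: top_class_closure_def)

lemma filter_congruence_restrict: "\<theta> = filter_congruence top_class_closure \<inter> (U \<times> U)"
proof -
  have "(x, y) \<in> \<theta> \<longleftrightarrow> (x, y) \<in> filter_congruence top_class_closure" if "x \<in> U" "y \<in> U" for x y
    unfolding congruence_on_iff_bicond[OF that] filter_congruence_def
    by (simp add: top_class_closure_iff bicond_in that)
  then show ?thesis
    using cong_in by (intro equalityI subrelI) blast+
qed

end

section \<open>The congruence extension property\<close>

theorem proposition4p15:
  fixes U :: "'a::subresiduated_nelson_algebra set"
    and \<theta> :: "('a \<times> 'a) set"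
  assumes "subalgebra U"
    and "congruence_on U \<theta>"
  shows "\<exists>\<theta>'. congruence_on UNIV \<theta>' \<and> \<theta> = \<theta>' \<inter> (U \<times> U)"
  using congruence_on_filter_congruence[OF entailment_filter_top_class_closure[OF assms]]
    filter_congruence_restrict[OF assms]
  by blast

end
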